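(* Let $D$ be a subset of $\mathbb{R}^d$, $Y$ a set and $y_0\in Y$. Then for any $f\in\mathrm{Map}(\mathbb{R}^d,Y)$, $f$ is $D$-equivariant if and only if $f$ is locally derivable from $D$. Here $D$ is regarded as an element of $2^{\mathbb{R}^d}$, which is an abstract pattern space over $(\mathbb{R}^d,\mathbb{R}^d)$, and $f$ as an element of $\mathrm{Map}(\mathbb{R}^d,Y,y_0)$, which is an abstract pattern space over $(\mathbb{R}^d,\mathbb{R}^d)$ ($\mathbb{R}^d$ acting on itself by translations).
   Context: $B(x,r)$ denotes the closed Euclidean ball. $f\colon\mathbb{R}^d\to Y$ is (strongly) $D$-equivariant if there is $R>0$ such that for all $x,y\in\mathbb{R}^d$, $(D-x)\cap B(0,R)=(D-y)\cap B(0,R)$ implies $f(x)=f(y)$. $2^{\mathbb{R}^d}$ is the set of all subsets of $\mathbb{R}^d$ with cutting-off $D\wedge C=D\cap C$ for closed $C$ and action by translation. $\mathrm{Map}(\mathbb{R}^d,Y,y_0)$ is the set $\mathrm{Map}(\mathbb{R}^d,Y)$ of all maps $f\colon\mathbb{R}^d\to Y$ with cutting-off $(f\wedge C)(x)=f(x)$ if $x\in C$ and $y_0$ if $x\notin C$, and action $(\gamma f)(x)=f(\gamma^{-1}x)$. Local derivability (for the group $\Gamma=\mathbb{R}^d$ of translations): $\mathcal{P}_2$ is locally derivable from $\mathcal{P}_1$ if there are $x_0,y_0'\in\mathbb{R}^d$ and $R_0\geqq0$ such that for all $\gamma,\eta\in\Gamma$ and $R\geqq0$: $(\gamma\mathcal{P}_1)\wedge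 B(x_0,R+R_0)=(\eta\mathcal{P}_1)\wedge B(x_0,R+R_0)$ implies $(\gamma\mathcal{P}_2)\wedge B(y_0',R)=(\eta\mathcal{P}_2)\wedge B(y_0',R)$. *)

theory Defs
  imports "HOL-Analysis.Analysis"
begin

definition equivariant :: "(real^'d) set \<Rightarrow> (real^'d \<Rightarrow> 'y) \<Rightarrow> bool" where
  "equivariant D f \<longleftrightarrow>
    (\<exists>R>0. \<forall>x y. (\<lambda>z. z - x) ` D \<inter> cball 0 R = (\<lambda>z. z - y) ` D \<inter> cball 0 R \<longrightarrow> f x = f y)"

text \<open>
  The operations of an abstract pattern space over \<open>(\<real>\<^sup>d, \<real>\<^sup>d)\<close>, on patterns of type \<open>'p\<close>:
  cutting off along a subset of \<open>\<real>\<^sup>d\<close> (only closed subsets are meaningful), and the action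
  of the translation by a vector.
\<close>

record ('p, 'd :: finite) pattern_ops =
  cut :: "'p \<Rightarrow> (real^'d) set \<Rightarrow> 'p"
  act :: "real^'d \<Rightarrow> 'p \<Rightarrow> 'p"

definition subset_patterns :: "((real^'d) set, 'd) pattern_ops" where
  "subset_patterns = \<lparr>cut = (\<lambda>D C. D \<inter> C), act = (\<lambda>\<gamma> D. (\<lambda>z. \<gamma> + z) ` D)\<rparr>"

definition map_patterns :: "'y \<Rightarrow> (real^'d \<Rightarrow> 'y, 'd) pattern_ops" where
  "map_patterns y\<^sub>0 =
    \<lparr>cut = (\<lambda>f C x. if x \<in> C then f x else y\<^sub>0), act = (\<lambda>\<gamma> f x. f (- \<gamma> + x))\<rparr>"

text \<open>
  \<open>locally_derivable \<Pi>\<^sub>1 P\<^sub>1 \<Pi>\<^sub>2 P\<^sub>2\<close>: the pattern \<open>P\<^sub>2\<close> of \<open>\<Pi>\<^sub>2\<close> is locally derivable from the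
  pattern \<open>P\<^sub>1\<close> of \<open>\<Pi>\<^sub>1\<close>.
\<close>

definition locally_derivable ::
  "('p, 'd::finite) pattern_ops \<Rightarrow> 'p \<Rightarrow> ('q, 'd) pattern_ops \<Rightarrow> 'q \<Rightarrow> bool" where
  "locally_derivable \<Pi>\<^sub>1 P\<^sub>1 \<Pi>\<^sub>2 P\<^sub>2 \<longleftrightarrow>
    (\<exists>x\<^sub>0 y\<^sub>0 R\<^sub>0. R\<^sub>0 \<ge> 0 \<and> (\<forall>\<gamma> \<eta> R. R \<ge> 0 \<longrightarrow>
       cut \<Pi>\<^sub>1 (act \<Pi>\<^sub>1 \<gamma> P\<^sub>1) (cball x\<^sub>0 (R + R\<^sub>0)) = cut \<Pi>\<^sub>1 (act \<Pi>\<^sub>1 \<eta> P\<^sub>1) (cball x\<^sub>0 (R + R\<^sub>0)) \<longrightarrow>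
       cut \<Pi>\<^sub>2 (act \<Pi>\<^sub>2 \<gamma> P\<^sub>2) (cball y\<^sub>0 R) = cut \<Pi>\<^sub>2 (act \<Pi>\<^sub>2 \<eta> P\<^sub>2) (cball y\<^sub>0 R)))"

end

theory Submission
  imports Defs
begin

text \<open>
  Both conditions compare \<open>D\<close> near two points, and \<open>f\<close> at (or near) these points. Say that
  \<open>D\<close> agrees to radius \<open>r\<close> at \<open>x\<close> and \<open>y\<close> when \<open>D - x\<close> and \<open>D - y\<close> agree on the ball of
  radius \<open>r\<close> about 0.

  If agreement to radius \<open>r\<close> at \<open>x\<close> and \<open>y\<close> forces \<open>f x = f y\<close>, then \<open>R\<^sub>0 = r\<close> works for local
  derivability with both base points at 0: when \<open>D + \<gamma>\<close> and \<open>D + \<eta>\<close> agree on the ball of radius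
  \<open>R + r\<close>, they agree by the triangle inequality on the ball of radius \<open>r\<close> about each \<open>p\<close> with
  \<open>\<parallel>p\<parallel> \<le> R\<close>, so \<open>f (p - \<gamma>) = f (p - \<eta>)\<close>.

  Conversely, radius \<open>R = 0\<close> alone already gives equivariance: there the conclusion of local
  derivability with base points \<open>a\<close> and \<open>b\<close> is the single equation
  \<open>f (b - \<gamma>) = f (b - \<eta>)\<close>, which is \<open>f x = f y\<close> for
  \<open>\<gamma> = b - x\<close> and \<open>\<eta> = b - y\<close>. The hypothesis concerns the ball of radius \<open>R\<^sub>0\<close> about
  \<open>a\<close> rather than \<open>b\<close>; enlarging the radius by the distance of the base points absorbs
  the offset.
\<close>

text \<open>
  The next three lemmas turn equality of cut-off patterns into pointwise conditions, so that
  changing base points and radii becomes a substitution plus a triangle inequality.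
\<close>

lemma recentred_patches_eq_iff:
  fixes D :: "'a::real_normed_vector set"
  shows "(\<lambda>z. z - x) ` D \<inter> cball 0 r = (\<lambda>z. z - y) ` D \<inter> cball 0 r \<longleftrightarrow>
    (\<forall>v. norm v \<le> r \<longrightarrow> (x + v \<in> D \<longleftrightarrow> y + v \<in> D))"
proof -
  have "v \<in> (\<lambda>z. z - w) ` D \<longleftrightarrow> w + v \<in> D" for v w
    by (auto intro: rev_image_eqI[of "w + v"])
  then show ?thesis
    unfolding set_eq_iff Int_iff mem_cball_0 by blast
qed

lemma cut_subset_patterns_eq_iff:
  "cut subset_patterns (act subset_patterns \<gamma> D) (cball c r) =
     cut subset_patterns (act subset_patterns \<eta> D) (cball c r) \<longleftrightarrow>
   (\<forall>z. dist c z \<le> r \<longrightarrow> (z - \<gamma> \<in> D \<longleftrightarrow> z - \<eta> \<in> D))"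
proof -
  have "z \<in> (\<lambda>z. w + z) ` D \<longleftrightarrow> z - w \<in> D" for z w
    by (auto intro: rev_image_eqI[of "z - w"])
  then show ?thesis
    unfolding subset_patterns_def pattern_ops.simps set_eq_iff Int_iff mem_cball by blast
qed

lemma cut_map_patterns_eq_iff:
  fixes f :: "real^'b \<Rightarrow> 'a"
  shows "cut (map_patterns y\<^sub>0) (act (map_patterns y\<^sub>0) \<gamma> f) (cball c r) =
     cut (map_patterns y\<^sub>0) (act (map_patterns y\<^sub>0) \<eta> f) (cball c r) \<longleftrightarrow>
   (\<forall>p. dist c p \<le> r \<longrightarrow> f (p - \<gamma>) = f (p - \<eta>))"
  unfolding map_patterns_def pattern_ops.simps fun_eq_iff mem_cball uminus_add_conv_diff
  by metis

theorem lemma5p4: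
  fixes D :: "(real^'d) set" and f :: "real^'d \<Rightarrow> 'y" and y\<^sub>0 :: 'y
  shows "equivariant D f \<longleftrightarrow> locally_derivable subset_patterns D (map_patterns y\<^sub>0) f"
proof
  assume "equivariant D f"
  then obtain r where "r > 0"
    and equiv: "\<And>x y. (\<And>v. norm v \<le> r \<Longrightarrow> x + v \<in> D \<longleftrightarrow> y + v \<in> D) \<Longrightarrow> f x = f y"
    unfolding equivariant_def recentred_patches_eq_iff by blast
  have "f (p - \<gamma>) = f (p - \<eta>)"
    if agree: "\<And>z. dist 0 z \<le> R + r \<Longrightarrow> z - \<gamma> \<in> D \<longleftrightarrow> z - \<eta> \<in> D" and p: "dist 0 p \<le> R"
    for \<gamma> \<eta> p R
  proof (rule equiv)
    fix v :: "real^'d"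
    assume "norm v \<le> r"
    then have "dist 0 (p + v) \<le> R + r"
      using p norm_triangle_ineq[of p v] by simp
    from agree[OF this] show "p - \<gamma> + v \<in> D \<longleftrightarrow> p - \<eta> + v \<in> D"
      by (simp add: algebra_simps)
  qed
  then show "locally_derivable subset_patterns D (map_patterns y\<^sub>0) f"
    unfolding locally_derivable_def cut_subset_patterns_eq_iff cut_map_patterns_eq_iff
    using \<open>r > 0\<close> by (intro exI[of _ 0] exI[of _ r] conjI allI impI) (simp, blast)
next
  assume "locally_derivable subset_patterns D (map_patterns y\<^sub>0) f"
  then obtain a b R\<^sub>0 where "R\<^sub>0 \<ge> 0"
    and local: "\<forall>\<gamma> \<eta> R. R \<ge> 0 \<longrightarrow>
      (\<forall>z. dist a z \<le> R + R\<^sub>0 \<longrightarrow> (z - \<gamma> \<in> D \<longleftrightarrow> z - \<eta> \<in> D)) \<longrightarrow>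
      (\<forall>p. dist b p \<le> R \<longrightarrow> f (p - \<gamma>) = f (p - \<eta>))"
    unfolding locally_derivable_def cut_subset_patterns_eq_iff cut_map_patterns_eq_iff
    by (elim exE conjE)
  have deriv: "f (b - \<gamma>) = f (b - \<eta>)"
    if "\<And>z. dist a z \<le> R\<^sub>0 \<Longrightarrow> z - \<gamma> \<in> D \<longleftrightarrow> z - \<eta> \<in> D" for \<gamma> \<eta>
    using local[rule_format, of 0 \<gamma> \<eta> b] that by simp
  \<comment> \<open>The summand 1 only makes the radius positive, also when \<open>a = b\<close> and \<open>R\<^sub>0 = 0\<close>.\<close>
  define r where "r = R\<^sub>0 + dist a b + 1"
  have "f x = f y" if agree: "\<And>v. norm v \<le> r \<Longrightarrow> x + v \<in> D \<longleftrightarrow> y + v \<in> D" for x y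
  proof -
    have "z - (b - x) \<in> D \<longleftrightarrow> z - (b - y) \<in> D" if "dist a z \<le> R\<^sub>0" for z
    proof -
      have "norm (z - b) \<le> r"
        using that dist_triangle3[of z b a] by (simp add: r_def dist_norm)
      from agree[OF this] show ?thesis
        by (simp add: algebra_simps)
    qed
    from deriv[OF this] show ?thesis
      by simp
  qed
  moreover have "r > 0"
    using \<open>R\<^sub>0 \<ge> 0\<close> by (simp add: r_def add_nonneg_pos)
  ultimately show "equivariant D f"
    unfolding equivariant_def recentred_patches_eq_iff by blast
qed

end
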